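(* Let $\mathcal{G}=\{G_1,\dots,G_n\}$ be an instance of $k$-CMedians in $\mathbb{R}^d$, let $\epsilon>0$, and let $\mathcal{C}=\{c_1,\dots,c_k\}$ be the set of $(1+\epsilon)$-approximate median points of the $k$ clusters generated by a $c$-approximation $k$-medians algorithm on the points $\bigcup_{i=1}^n G_i$. Then $[\mathcal{C}]^k=\underbrace{\mathcal{C}\times\cdots\times\mathcal{C}}_{k}$ contains at least one $k$-tuple whose elements are the $k$ median points of a $\big((2+\epsilon)ck^2+(2+\epsilon)k+1\big)$-approximation of $k$-CMedians on $\mathcal{G}$.
   Context: An instance of $k$-CMedians is a set $\mathcal{G}=\{G_1,\dots,G_n\}$ of $n$ point-sets, each $G_i=\{p^i_1,\dots,p^i_{k_i}\}$ consisting of $k_i\le k$ points in $\mathbb{R}^d$. A chromatic partition of $\mathcal{G}$ is a partition of the $\sum_i k_i$ points into $k$ sets $U_1,\dots,U_k$ such that each $U_j$ contains at most one point from each $G_i$. The $k$-CMedians problem is to find $m_1,\dots,m_k\in\mathbb{R}^d$ and a chromatic partition $U_1,\dots,U_k$ minimizing $\frac1n\sum_j\sum_{q\in U_j}\|q-m_j\|$. For a finite nonempty set $Q\subset\mathbb{R}^d$, an optimal median point is a point $m$ minimizing $\sum_{q\in Q}\|q-m\|$, and a $(1+\epsilon)$-approximate median point is a point whose sum of distances to $Q$ is at most $(1+\epsilon)$ times this minimum. A $c$-approximation $k$-medians algorithm on a finite point set $Q$ produces a partition of $Q$ into $k$ clusters $S_1,\dots,S_k$ whose $k$-medians cost (the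 sum over clusters of distances of the points to an optimal median point of their cluster) is at most $c$ times the minimum such cost over all partitions of $Q$ into $k$ clusters; $c_j$ is a $(1+\epsilon)$-approximate median point of $S_j$. A $k$-tuple $(x_1,\dots,x_k)$ (repetitions allowed) gives the median points of a $\rho$-approximation if there is a chromatic partition $U_1,\dots,U_k$ of $\mathcal{G}$ such that $\frac1n\sum_j\sum_{q\in U_j}\|q-x_j\|$ is at most $\rho$ times the optimal $k$-CMedians objective value. *)

theory Defs
  imports "HOL-Analysis.Analysis"
begin

text \<open>
  Points of different \<open>G i\<close> may coincide in space but still count separately (there are
  \<open>\<Sum>i. card (G i)\<close> points in total), so a point is represented by the pair \<open>(i, q)\<close> of its
  colour \<open>i\<close> and its position \<open>q \<in> G i\<close>. All clusterings are clusterings of such pairs.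
\<close>

definition cmedians_instance :: "nat \<Rightarrow> nat \<Rightarrow> (nat \<Rightarrow> 'a::euclidean_space set) \<Rightarrow> bool" where
  "cmedians_instance n k G \<longleftrightarrow>
     0 < n \<and> 0 < k \<and> (\<forall>i\<in>{1..n}. finite (G i) \<and> card (G i) \<le> k)"

definition points :: "nat \<Rightarrow> (nat \<Rightarrow> 'a::euclidean_space set) \<Rightarrow> (nat \<times> 'a) set" where
  "points n G = (SIGMA i:{1..n}. G i)"

definition dist_sum :: "(nat \<times> 'a::euclidean_space) set \<Rightarrow> 'a \<Rightarrow> real" where
  "dist_sum S m = (\<Sum>(i, q)\<in>S. norm (q - m))"

definition optimal_median :: "(nat \<times> 'a::euclidean_space) set \<Rightarrow> 'a \<Rightarrow> bool" where
  "optimal_median S m \<longleftrightarrow> (\<forall>x. dist_sum S m \<le> dist_sum S x)"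

text \<open>
  The infima below are minima: see \<open>optimal_median_exists\<close>, \<open>median_cost_eq\<close>,
  \<open>kmedians_opt_attained\<close> and \<open>cmedians_opt_attained\<close>.
\<close>

definition median_cost :: "(nat \<times> 'a::euclidean_space) set \<Rightarrow> real" where
  "median_cost S = (INF m. dist_sum S m)"

definition approx_median :: "real \<Rightarrow> (nat \<times> 'a::euclidean_space) set \<Rightarrow> 'a \<Rightarrow> bool" where
  "approx_median \<epsilon> S m \<longleftrightarrow> dist_sum S m \<le> (1 + \<epsilon>) * median_cost S"

text \<open>Clusters may be empty; a partition into \<open>k\<close> clusters thus exists even for fewer than \<open>k\<close> points.\<close>

definition k_partition :: "nat \<Rightarrow> 'p set \<Rightarrow> (nat \<Rightarrow> 'p set) \<Rightarrow> bool" where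
  "k_partition k P S \<longleftrightarrow> disjoint_family_on S {1..k} \<and> (\<Union>j\<in>{1..k}. S j) = P"

definition kmedians_cost :: "nat \<Rightarrow> (nat \<Rightarrow> (nat \<times> 'a::euclidean_space) set) \<Rightarrow> real" where
  "kmedians_cost k S = (\<Sum>j=1..k. median_cost (S j))"

definition kmedians_opt :: "nat \<Rightarrow> (nat \<times> 'a::euclidean_space) set \<Rightarrow> real" where
  "kmedians_opt k P = (INF S\<in>{S. k_partition k P S}. kmedians_cost k S)"

definition approx_kmedians ::
  "real \<Rightarrow> nat \<Rightarrow> (nat \<times> 'a::euclidean_space) set \<Rightarrow> (nat \<Rightarrow> (nat \<times> 'a) set) \<Rightarrow> bool" where
  "approx_kmedians c k P S \<longleftrightarrow> k_partition k P S \<and> kmedians_cost k S \<le> c * kmedians_opt k P"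

definition chromatic_partition ::
  "nat \<Rightarrow> nat \<Rightarrow> (nat \<Rightarrow> 'a::euclidean_space set) \<Rightarrow> (nat \<Rightarrow> (nat \<times> 'a) set) \<Rightarrow> bool" where
  "chromatic_partition n k G U \<longleftrightarrow>
     k_partition k (points n G) U \<and>
     (\<forall>j\<in>{1..k}. \<forall>i\<in>{1..n}. card (U j \<inter> ({i} \<times> G i)) \<le> 1)"

definition cmedians_cost ::
  "nat \<Rightarrow> nat \<Rightarrow> (nat \<Rightarrow> (nat \<times> 'a::euclidean_space) set) \<Rightarrow> (nat \<Rightarrow> 'a) \<Rightarrow> real" where
  "cmedians_cost n k U m = 1 / real n * (\<Sum>j=1..k. dist_sum (U j) (m j))"

definition cmedians_opt :: "nat \<Rightarrow> nat \<Rightarrow> (nat \<Rightarrow> 'a::euclidean_space set) \<Rightarrow> real" where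
  "cmedians_opt n k G =
     (INF (m, U)\<in>{(m, U). chromatic_partition n k G U}. cmedians_cost n k U m)"

definition gives_cmedians_approx ::
  "nat \<Rightarrow> nat \<Rightarrow> (nat \<Rightarrow> 'a::euclidean_space set) \<Rightarrow> real \<Rightarrow> (nat \<Rightarrow> 'a) \<Rightarrow> bool" where
  "gives_cmedians_approx n k G \<rho> x \<longleftrightarrow>
     (\<exists>U. chromatic_partition n k G U \<and> cmedians_cost n k U x \<le> \<rho> * cmedians_opt n k G)"


lemma dist_sum_nonneg: "0 \<le> dist_sum S m"
  unfolding dist_sum_def by (auto intro: sum_nonneg)

lemma optimal_median_exists:
  fixes S :: "(nat \<times> 'a::euclidean_space) set"
  assumes "finite S"
  shows "\<exists>m. optimal_median S m"
proof (cases "S = {}")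
  case True
  then show ?thesis by (simp add: optimal_median_def dist_sum_def)
next
  case False
  then obtain i0 q0 where q0: "(i0, q0) \<in> S" by auto
  define R where "R = dist_sum S q0"
  have R0: "0 \<le> R" by (simp add: R_def dist_sum_nonneg)
  have cont: "continuous_on (cball q0 R) (dist_sum S)"
    unfolding dist_sum_def case_prod_beta by (intro continuous_intros)
  have "cball q0 R \<noteq> {}" using R0 by simp
  then obtain m where m: "\<And>y. y \<in> cball q0 R \<Longrightarrow> dist_sum S m \<le> dist_sum S y"
    using continuous_attains_inf[OF compact_cball _ cont] by blast
  have "dist_sum S m \<le> dist_sum S x" for x
  proof (cases "x \<in> cball q0 R")
    case True
    then show ?thesis by (rule m)
  next
    case False
    have "dist_sum S m \<le> R" using m[of q0] R0 by (simp add: R_def)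
    also have "R \<le> norm (q0 - x)" using False by (simp add: dist_norm)
    also have "\<dots> \<le> dist_sum S x"
      unfolding dist_sum_def
      using member_le_sum[of "(i0, q0)" S "\<lambda>(i, q). norm (q - x)"] q0 assms by auto
    finally show ?thesis .
  qed
  then show ?thesis unfolding optimal_median_def by blast
qed

lemma median_cost_eq: "optimal_median S m \<Longrightarrow> median_cost S = dist_sum S m"
  unfolding median_cost_def optimal_median_def by (intro cInf_eq_minimum) auto

lemma median_cost_le: "median_cost S \<le> dist_sum S m"
  unfolding median_cost_def by (rule cINF_lower) (auto intro: bdd_belowI[of _ 0] simp: dist_sum_nonneg)

lemma finite_points: "cmedians_instance n k G \<Longrightarrow> finite (points n G)"
  unfolding cmedians_instance_def points_def by auto

lemma finite_kmedians_costs: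
  fixes P :: "(nat \<times> 'a::euclidean_space) set"
  assumes "finite P"
  shows "finite (kmedians_cost k ` {S. k_partition k P S})"
proof (rule finite_subset)
  show "kmedians_cost k ` {S. k_partition k P S} \<subseteq> kmedians_cost k ` ({1..k} \<rightarrow>\<^sub>E Pow P)"
  proof clarify
    fix S assume S: "k_partition k P S"
    have "restrict S {1..k} \<in> {1..k} \<rightarrow>\<^sub>E Pow P"
      using S by (auto simp: k_partition_def)
    moreover have "kmedians_cost k S = kmedians_cost k (restrict S {1..k})"
      by (simp add: kmedians_cost_def)
    ultimately show "kmedians_cost k S \<in> kmedians_cost k ` ({1..k} \<rightarrow>\<^sub>E Pow P)" by blast
  qed
  show "finite (kmedians_cost k ` ({1..k} \<rightarrow>\<^sub>E Pow P))"
    using assms by (intro finite_imageI finite_PiE) auto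
qed

lemma kmedians_opt_attained:
  fixes P :: "(nat \<times> 'a::euclidean_space) set"
  assumes "finite P" "0 < k"
  shows "\<exists>S. k_partition k P S \<and> kmedians_cost k S = kmedians_opt k P"
proof -
  have "k_partition k P (\<lambda>j. if j = 1 then P else {})"
    using assms(2) by (auto simp: k_partition_def disjoint_family_on_def split: if_splits)
  then have ne: "kmedians_cost k ` {S. k_partition k P S} \<noteq> {}" by blast
  have "kmedians_opt k P \<in> kmedians_cost k ` {S. k_partition k P S}"
    unfolding kmedians_opt_def
    using finite_kmedians_costs[OF assms(1)] ne by (metis Min_in cInf_eq_Min)
  then show ?thesis by auto
qed

lemma chromatic_partition_exists:
  assumes "cmedians_instance n k G"
  shows "\<exists>U. chromatic_partition n k G U"
proof -
  have "\<forall>i\<in>{1..n}. \<exists>f. f ` G i \<subseteq> {1..k} \<and> inj_on f (G i)"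
    using assms unfolding cmedians_instance_def by (auto intro!: card_le_inj)
  then obtain f where f: "\<And>i. i \<in> {1..n} \<Longrightarrow> f i ` G i \<subseteq> {1..k} \<and> inj_on (f i) (G i)"
    by metis
  define U where "U j = {(i, q). i \<in> {1..n} \<and> q \<in> G i \<and> f i q = j}" for j
  have "card (U j \<inter> ({i} \<times> G i)) \<le> 1" if "i \<in> {1..n}" for i j
  proof -
    have "finite (U j \<inter> ({i} \<times> G i))"
      using assms that unfolding cmedians_instance_def by auto
    then show ?thesis
      using f[OF that] by (auto simp: card_le_Suc0_iff_eq U_def inj_on_def)
  qed
  moreover have "k_partition k (points n G) U"
    using f unfolding k_partition_def disjoint_family_on_def points_def
    by (fastforce simp: U_def)
  ultimately show ?thesis unfolding chromatic_partition_def by blast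
qed

lemma cmedians_opt_attained:
  fixes G :: "nat \<Rightarrow> 'a::euclidean_space set"
  assumes inst: "cmedians_instance n k G"
  shows "\<exists>m U. chromatic_partition n k G U \<and> cmedians_cost n k U m = cmedians_opt n k G"
proof -
  define K where "K = kmedians_cost k ` {U. chromatic_partition n k G U}"
  have "finite K"
    unfolding K_def
    by (rule finite_subset[OF _ finite_kmedians_costs[OF finite_points[OF inst]]])
      (auto simp: chromatic_partition_def)
  moreover have "K \<noteq> {}" unfolding K_def using chromatic_partition_exists[OF inst] by blast
  ultimately have "Min K \<in> K" by (rule Min_in)
  then obtain U where U: "chromatic_partition n k G U" "kmedians_cost k U = Min K"
    unfolding K_def by (elim imageE) simp
  have le: "kmedians_cost k U \<le> kmedians_cost k V" if "chromatic_partition n k G V" for V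
    using that U(2) Min_le[OF \<open>finite K\<close>] unfolding K_def by auto
  have "\<exists>m. \<forall>j\<in>{1..k}. optimal_median (U j) (m j)"
  proof -
    have "finite (U j)" if "j \<in> {1..k}" for j
    proof (rule finite_subset)
      show "U j \<subseteq> points n G"
        using U(1) that unfolding chromatic_partition_def k_partition_def by blast
    qed (rule finite_points[OF inst])
    then show ?thesis by (intro bchoice ballI optimal_median_exists)
  qed
  then obtain m where m: "\<And>j. j \<in> {1..k} \<Longrightarrow> optimal_median (U j) (m j)" by blast
  have cost: "cmedians_cost n k U m = 1 / real n * kmedians_cost k U"
    unfolding cmedians_cost_def kmedians_cost_def
    by (intro arg_cong[where f = "(*) (1 / real n)"] sum.cong refl median_cost_eq[symmetric] m)
  have "cmedians_cost n k U m \<le> cmedians_cost n k V x" if "chromatic_partition n k G V" for V x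
  proof -
    have "kmedians_cost k U \<le> (\<Sum>j=1..k. dist_sum (V j) (x j))"
      using le[OF that] sum_mono[of "{1..k}" "\<lambda>j. median_cost (V j)" "\<lambda>j. dist_sum (V j) (x j)"]
      by (simp add: median_cost_le kmedians_cost_def)
    then show ?thesis unfolding cost unfolding cmedians_cost_def
      by (intro mult_left_mono) auto
  qed
  then have "cmedians_opt n k G = cmedians_cost n k U m"
    unfolding cmedians_opt_def using U(1) by (intro cInf_eq_minimum) auto
  then show ?thesis using U(1) by metis
qed

end

theory Submission
  imports Defs
begin

text \<open>
  Keep an optimal chromatic partition \<open>U\<close> with medians \<open>m j\<close> and move each \<open>m j\<close> to the centre
  of the cluster \<open>S (l j)\<close> that contains the most points of \<open>U j\<close>, hence at least a fraction
  \<open>1 / k\<close> of them. By the triangle inequality through the points of \<open>U j \<inter> S (l j)\<close>, the move costs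
  at most \<open>k\<close> times the distances of these points to \<open>m j\<close> and to the centre. Summing over \<open>j\<close>, the
  former add up to at most the optimal \<open>k\<close>-CMedians cost \<open>W\<close> (without the factor \<open>1 / n\<close>), and the
  latter to at most the cost of the clusters \<open>S\<close>, which is at most \<open>(1 + \<epsilon>) * c * W\<close>. The total
  \<open>1 + k + (1 + \<epsilon>) * c * k\<close> is below the factor claimed.
\<close>

lemma dist_sum_mono:
  assumes "finite B" "A \<subseteq> B"
  shows "dist_sum A m \<le> dist_sum B m"
  unfolding dist_sum_def by (rule sum_mono2) (use assms in auto)

lemma k_partition_Int:
  assumes "k_partition k P S" "A \<subseteq> P"
  shows "(\<Union>j\<in>{1..k}. A \<inter> S j) = A"
    and "\<forall>i\<in>{1..k}. \<forall>j\<in>{1..k}. i \<noteq> j \<longrightarrow> (A \<inter> S i) \<inter> (A \<inter> S j) = {}"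
  using assms unfolding k_partition_def disjoint_family_on_def by blast+

lemma dist_sum_k_partition:
  assumes "finite P" "k_partition k P S" "A \<subseteq> P"
  shows "dist_sum A m = (\<Sum>j=1..k. dist_sum (A \<inter> S j) m)"
proof -
  have "finite A" using assms finite_subset by blast
  then have "(\<Sum>p\<in>(\<Union>j\<in>{1..k}. A \<inter> S j). case p of (i, q) \<Rightarrow> norm (q - m))
      = (\<Sum>j=1..k. dist_sum (A \<inter> S j) m)"
    unfolding dist_sum_def using k_partition_Int(2)[OF assms(2,3)]
    by (intro sum.UNION_disjoint) auto
  then show ?thesis
    unfolding k_partition_Int(1)[OF assms(2,3)] dist_sum_def .
qed

text \<open>Pigeonhole: otherwise the \<open>k\<close> cells together would have fewer than
  \<open>card A\<close> points. The product form avoids division and covers empty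
  \<open>A\<close>.\<close>

lemma large_cell_exists:
  assumes "finite P" "k_partition k P S" "A \<subseteq> P" "0 < k"
  shows "\<exists>l\<in>{1..k}. card A \<le> k * card (A \<inter> S l)"
proof (rule ccontr)
  assume "\<not> ?thesis"
  then have less: "k * card (A \<inter> S l) < card A" if "l \<in> {1..k}" for l
    using that by (simp add: not_le)
  have "finite A" using assms finite_subset by blast
  then have "card (\<Union>j\<in>{1..k}. A \<inter> S j) = (\<Sum>l=1..k. card (A \<inter> S l))"
    using k_partition_Int(2)[OF assms(2,3)] by (intro card_UN_disjoint) auto
  then have "k * card A = (\<Sum>l=1..k. k * card (A \<inter> S l))"
    unfolding k_partition_Int(1)[OF assms(2,3)] by (simp add: sum_distrib_left)
  also have "\<dots> < (\<Sum>l=1..k. card A)"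
    using assms(4) less by (intro sum_strict_mono) auto
  finally show False by simp
qed

text \<open>Each point of \<open>T\<close> gives one triangle inequality between \<open>m\<close>
  and \<open>y\<close>. For infinite \<open>T\<close> both sides are 0.\<close>

lemma card_mult_dist_le:
  fixes T :: "(nat \<times> 'a::euclidean_space) set"
  shows "real (card T) * norm (m - y) \<le> dist_sum T m + dist_sum T y"
proof -
  have "real (card T) * norm (m - y) = (\<Sum>p\<in>T. norm (m - y))" by simp
  also have "\<dots> \<le> (\<Sum>p\<in>T. norm (snd p - m) + norm (snd p - y))"
    by (rule sum_mono) (metis dist_norm dist_triangle3)
  finally show ?thesis by (simp add: dist_sum_def case_prod_beta sum.distrib)
qed

lemma dist_sum_shift:
  fixes A :: "(nat \<times> 'a::euclidean_space) set"
  shows "dist_sum A y \<le> dist_sum A m + real (card A) * norm (m - y)"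
proof -
  have "dist_sum A y \<le> (\<Sum>p\<in>A. norm (snd p - m) + norm (m - y))"
    unfolding dist_sum_def case_prod_beta
    by (rule sum_mono) (metis dist_norm dist_triangle)
  then show ?thesis by (simp add: dist_sum_def case_prod_beta sum.distrib)
qed

text \<open>Meant for a chromatic \<open>U\<close>: dropping the colour constraint can only lower
  the optimum.\<close>

lemma kmedians_opt_le:
  assumes "finite P" "k_partition k P U"
  shows "kmedians_opt k P \<le> kmedians_cost k U"
  unfolding kmedians_opt_def using assms
  by (intro cINF_lower bdd_below_finite finite_kmedians_costs) auto

text \<open>The reassignment argument for arbitrary centres \<open>m\<close> and \<open>y\<close>;
  optimality and approximation factors enter only in the theorem.\<close>

lemma sum_dist_sum_move_le:
  fixes P :: "(nat \<times> 'a::euclidean_space) set"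
  assumes "finite P" "0 < k" "k_partition k P U" "k_partition k P S"
  shows "\<exists>l\<in>{1..k} \<rightarrow> {1..k}. (\<Sum>j=1..k. dist_sum (U j) (y (l j)))
    \<le> (1 + real k) * (\<Sum>j=1..k. dist_sum (U j) (m j))
      + real k * (\<Sum>j=1..k. dist_sum (S j) (y j))"
proof -
  have U_sub: "U j \<subseteq> P" and S_sub: "S j \<subseteq> P" if "j \<in> {1..k}" for j
    using assms(3,4) that unfolding k_partition_def by blast+
  have "\<forall>j\<in>{1..k}. \<exists>l\<in>{1..k}. card (U j) \<le> k * card (U j \<inter> S l)"
    using large_cell_exists[OF assms(1,4) U_sub assms(2)] by blast
  then obtain l where l: "\<And>j. j \<in> {1..k} \<Longrightarrow> l j \<in> {1..k}"
      "\<And>j. j \<in> {1..k} \<Longrightarrow> card (U j) \<le> k * card (U j \<inter> S (l j))"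
    by metis
  have move: "dist_sum (U j) (y (l j)) \<le> (1 + real k) * dist_sum (U j) (m j)
      + real k * (\<Sum>i=1..k. dist_sum (S i \<inter> U j) (y i))" if j: "j \<in> {1..k}" for j
  proof -
    let ?T = "U j \<inter> S (l j)" and ?y = "y (l j)"
    have "real (card (U j)) * norm (m j - ?y) \<le> real k * real (card ?T) * norm (m j - ?y)"
      using l(2)[OF j] by (intro mult_right_mono) (auto simp flip: of_nat_mult)
    also have "\<dots> \<le> real k * (dist_sum ?T (m j) + dist_sum ?T ?y)"
      unfolding mult.assoc by (intro mult_left_mono card_mult_dist_le) auto
    \<comment> \<open>The single cell \<open>l j\<close> is enlarged to all cells, so the bound no
      longer depends on \<open>l\<close>, and several \<open>j\<close> may share one cell.\<close>
    also have "\<dots> \<le> real k * (dist_sum (U j) (m j) + (\<Sum>i=1..k. dist_sum (S i \<inter> U j) (y i)))"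
    proof (intro mult_left_mono add_mono)
      show "dist_sum ?T (m j) \<le> dist_sum (U j) (m j)"
        using U_sub[OF j] assms(1) finite_subset by (intro dist_sum_mono) auto
      show "dist_sum ?T ?y \<le> (\<Sum>i=1..k. dist_sum (S i \<inter> U j) (y i))"
        using member_le_sum[of "l j" "{1..k}" "\<lambda>i. dist_sum (S i \<inter> U j) (y i)"] l(1)[OF j]
        by (simp add: dist_sum_nonneg Int_commute)
    qed simp
    finally show ?thesis
      using dist_sum_shift[of "U j" ?y "m j"] by (simp add: algebra_simps)
  qed
  have "(\<Sum>j=1..k. dist_sum (U j) (y (l j)))
    \<le> (\<Sum>j=1..k. (1 + real k) * dist_sum (U j) (m j)
        + real k * (\<Sum>i=1..k. dist_sum (S i \<inter> U j) (y i)))"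
    by (rule sum_mono) (rule move)
  also have "\<dots> = (1 + real k) * (\<Sum>j=1..k. dist_sum (U j) (m j))
        + real k * (\<Sum>j=1..k. \<Sum>i=1..k. dist_sum (S i \<inter> U j) (y i))"
    by (simp add: sum.distrib sum_distrib_left)
  \<comment> \<open>After the swap, the inner sum runs over the pieces into which \<open>U\<close>
    cuts \<open>S i\<close>.\<close>
  also have "(\<Sum>j=1..k. \<Sum>i=1..k. dist_sum (S i \<inter> U j) (y i)) = (\<Sum>i=1..k. dist_sum (S i) (y i))"
    by (subst sum.swap) (simp add: dist_sum_k_partition[OF assms(1,3) S_sub])
  finally show ?thesis using l(1) by (intro bexI[of _ l]) auto
qed

theorem theorem6:
  fixes G :: "nat \<Rightarrow> (real ^ 'd) set"
    and n k :: nat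
    and \<epsilon> c :: real
    and S :: "nat \<Rightarrow> (nat \<times> (real ^ 'd)) set"
    and ctr :: "nat \<Rightarrow> real ^ 'd"
    and C :: "(real ^ 'd) set"
  assumes "cmedians_instance n k G"
    and "\<epsilon> > 0"
    and "c \<ge> 1"
    and "approx_kmedians c k (points n G) S"
    and "\<And>j. j \<in> {1..k} \<Longrightarrow> approx_median \<epsilon> (S j) (ctr j)"
    and "C = ctr ` {1..k}"
  shows "\<exists>x \<in> {1..k} \<rightarrow>\<^sub>E C.
           gives_cmedians_approx n k G
             ((2 + \<epsilon>) * c * (real k)\<^sup>2 + (2 + \<epsilon>) * real k + 1) x"
proof -
  let ?\<rho> = "(2 + \<epsilon>) * c * (real k)\<^sup>2 + (2 + \<epsilon>) * real k + 1"
  have fin: "finite (points n G)" by (rule finite_points[OF assms(1)])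
  have k: "0 < k" using assms(1) by (simp add: cmedians_instance_def)
  have S: "k_partition k (points n G) S" "kmedians_cost k S \<le> c * kmedians_opt k (points n G)"
    using assms(4) by (auto simp: approx_kmedians_def)
  obtain m U where U: "chromatic_partition n k G U" "cmedians_cost n k U m = cmedians_opt n k G"
    using cmedians_opt_attained[OF assms(1)] by blast
  have partU: "k_partition k (points n G) U" using U(1) by (simp add: chromatic_partition_def)
  define W where "W = (\<Sum>j=1..k. dist_sum (U j) (m j))"
  have W0: "0 \<le> W" unfolding W_def by (intro sum_nonneg dist_sum_nonneg)
  obtain l where l: "l \<in> {1..k} \<rightarrow> {1..k}"
      "(\<Sum>j=1..k. dist_sum (U j) (ctr (l j)))
        \<le> (1 + real k) * W + real k * (\<Sum>j=1..k. dist_sum (S j) (ctr j))"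
    using sum_dist_sum_move_le[OF fin k partU S(1), of ctr m] unfolding W_def by blast
  have "kmedians_cost k S \<le> c * W"
  proof -
    \<comment> \<open>The optimal chromatic partition competes in the unconstrained k-medians
      problem.\<close>
    have "kmedians_cost k U \<le> W"
      unfolding kmedians_cost_def W_def by (intro sum_mono median_cost_le)
    then have "kmedians_opt k (points n G) \<le> W"
      using kmedians_opt_le[OF fin partU] by linarith
    then have "c * kmedians_opt k (points n G) \<le> c * W"
      using assms(3) by (intro mult_left_mono) auto
    then show ?thesis using S(2) by linarith
  qed
  moreover have "(\<Sum>j=1..k. dist_sum (S j) (ctr j)) \<le> (1 + \<epsilon>) * kmedians_cost k S"
    unfolding kmedians_cost_def sum_distrib_left
    by (rule sum_mono) (use assms(5) in \<open>simp add: approx_median_def\<close>)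
  ultimately have "(\<Sum>j=1..k. dist_sum (S j) (ctr j)) \<le> (1 + \<epsilon>) * (c * W)"
    using assms(2) mult_left_mono[of "kmedians_cost k S" "c * W" "1 + \<epsilon>"] by linarith
  then have "real k * (\<Sum>j=1..k. dist_sum (S j) (ctr j)) \<le> real k * ((1 + \<epsilon>) * (c * W))"
    by (intro mult_left_mono) auto
  then have "(\<Sum>j=1..k. dist_sum (U j) (ctr (l j))) \<le> (1 + real k + (1 + \<epsilon>) * c * real k) * W"
    using l(2) by (simp add: algebra_simps)
  also have "\<dots> \<le> ?\<rho> * W"
  proof (rule mult_right_mono[OF _ W0])
    \<comment> \<open>As \<open>k\<close> is at least 1, the term linear in \<open>k\<close> fits
      below the quadratic one.\<close>
    have "real k \<le> (real k)\<^sup>2" using k by (simp add: power2_eq_square)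
    then have "(1 + \<epsilon>) * c * real k \<le> (2 + \<epsilon>) * c * (real k)\<^sup>2"
      using assms(2,3) by (intro mult_mono) auto
    moreover have "real k \<le> (2 + \<epsilon>) * real k"
      using assms(2) by (simp add: algebra_simps)
    ultimately show "1 + real k + (1 + \<epsilon>) * c * real k \<le> ?\<rho>" by linarith
  qed
  finally have bound: "(\<Sum>j=1..k. dist_sum (U j) (ctr (l j))) \<le> ?\<rho> * W" .
  \<comment> \<open>\<open>restrict\<close> makes \<open>x\<close> extensional, as membership in the
    function space demands; the cost reads only the indices \<open>1..k\<close>.\<close>
  define x where "x = restrict (\<lambda>j. ctr (l j)) {1..k}"
  have "cmedians_cost n k U x = 1 / real n * (\<Sum>j=1..k. dist_sum (U j) (ctr (l j)))"
    by (simp add: cmedians_cost_def x_def)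
  also have "\<dots> \<le> 1 / real n * (?\<rho> * W)"
    by (intro mult_left_mono bound) auto
  also have "\<dots> = ?\<rho> * cmedians_opt n k G"
    unfolding U(2)[symmetric] cmedians_cost_def W_def by simp
  finally have "gives_cmedians_approx n k G ?\<rho> x"
    unfolding gives_cmedians_approx_def using U(1) by blast
  moreover have "x \<in> {1..k} \<rightarrow>\<^sub>E C"
    using l(1) assms(6) by (auto simp: x_def)
  ultimately show ?thesis by blast
qed

end
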